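(* Let $\mathscr{H}$ be a complex Hilbert space and let $T\in \mathbb{B}(\mathscr{H})$. Then $$w(T)=\sqrt{\frac14\|T^*T+TT^*\|+\frac12 \big| \|Re(T)\|^2-\|Im(T)\|^2\big|}$$ if and only if both $\frac12 \|T^*T+TT^*\|= \|Re(T)\|^2+\|Im(T)\|^2$ and $w(T)=\max\{\|Re(T)\|, \|Im(T)\|\}$.
   Context: $\mathbb{B}(\mathscr{H})$ denotes the bounded linear operators on $\mathscr{H}$, $\|\cdot\|$ the operator norm. $Re(T)=\frac12(T+T^* )$ and $Im(T)=\frac1{2i}(T-T^* )$. The numerical radius is $w(T)=\sup\{|\langle Tx,x\rangle| : x\in\mathscr{H},\ \|x\|=1\}$. *)

theory Defs
  imports "HOL-Analysis.Analysis"
begin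

class complex_vector = real_vector +
  fixes scaleC :: "complex \<Rightarrow> 'a \<Rightarrow> 'a" (infixr "*\<^sub>C" 75)
  assumes scaleC_add_right: "a *\<^sub>C (x + y) = a *\<^sub>C x + a *\<^sub>C y"
    and scaleC_add_left: "(a + b) *\<^sub>C x = a *\<^sub>C x + b *\<^sub>C x"
    and scaleC_scaleC: "a *\<^sub>C (b *\<^sub>C x) = (a * b) *\<^sub>C x"
    and scaleC_one: "1 *\<^sub>C x = x"
    and scaleR_scaleC: "r *\<^sub>R x = complex_of_real r *\<^sub>C x"

(* The inner product is linear in the first argument and conjugate-linear in the second. *)
class complex_inner = real_normed_vector + complex_vector +
  fixes cinner :: "'a \<Rightarrow> 'a \<Rightarrow> complex"
  assumes cinner_commute: "cinner x y = cnj (cinner y x)"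
    and cinner_add_left: "cinner (x + y) z = cinner x z + cinner y z"
    and cinner_scaleC_left: "cinner (c *\<^sub>C x) y = c * cinner x y"
    and cinner_self_ge_zero: "0 \<le> Re (cinner x x)"
    and cinner_self_eq_zero_iff: "cinner x x = 0 \<longleftrightarrow> x = 0"
    and norm_eq_sqrt_cinner: "norm x = sqrt (Re (cinner x x))"

class chilbert_space = complex_inner + banach

instantiation complex :: chilbert_space
begin

definition scaleC_complex :: "complex \<Rightarrow> complex \<Rightarrow> complex"
  where "scaleC_complex c x = c * x"

definition cinner_complex :: "complex \<Rightarrow> complex \<Rightarrow> complex"
  where "cinner_complex x y = x * cnj y"

instance
  by standard
    (simp_all add: scaleC_complex_def cinner_complex_def algebra_simps scaleR_conv_of_real
      cmod_def power2_eq_square)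

end

definition bounded_clinear :: "('a::complex_inner \<Rightarrow> 'a) \<Rightarrow> bool"
  where "bounded_clinear T \<longleftrightarrow> bounded_linear T \<and> (\<forall>c x. T (c *\<^sub>C x) = c *\<^sub>C T x)"

(* Meaningful for bounded operators on a Hilbert space, where such a map exists (Riesz);
   it is then unique, bounded and complex-linear. *)
definition cadjoint :: "('a::chilbert_space \<Rightarrow> 'a) \<Rightarrow> 'a \<Rightarrow> 'a"
  where "cadjoint T = (THE S. \<forall>x y. cinner (T x) y = cinner x (S y))"

definition real_part_op :: "('a::chilbert_space \<Rightarrow> 'a) \<Rightarrow> 'a \<Rightarrow> 'a"
  where "real_part_op T = (\<lambda>x. (1 / 2) *\<^sub>C (T x + cadjoint T x))"

definition imag_part_op :: "('a::chilbert_space \<Rightarrow> 'a) \<Rightarrow> 'a \<Rightarrow> 'a"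
  where "imag_part_op T = (\<lambda>x. (1 / (2 * \<i>)) *\<^sub>C (T x - cadjoint T x))"

(* All values are nonnegative, so inserting 0 only matters on the zero space, which has no
   unit vectors and where Sup {} would be an unspecified real: there the radius is 0. *)
definition numerical_radius :: "('a::complex_inner \<Rightarrow> 'a) \<Rightarrow> real"
  where "numerical_radius T = Sup (insert 0 {cmod (cinner (T x) x) | x. norm x = 1})"

end

theory Submission
  imports Defs
begin

text \<open>With \<open>H = Re T\<close> and \<open>K = Im T\<close> one has \<open>T\<^sup>*T + TT\<^sup>* = 2 (H\<^sup>2 + K\<^sup>2)\<close>, so half its norm is at most
  \<open>\<parallel>H\<parallel>\<^sup>2 + \<parallel>K\<parallel>\<^sup>2\<close>. Since \<open>\<langle>Hx,x\<rangle>\<close> and \<open>\<langle>Kx,x\<rangle>\<close> are the real and imaginary parts of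
  \<open>\<langle>Tx,x\<rangle>\<close> and \<open>H\<close>, \<open>K\<close> are self-adjoint, \<open>max \<parallel>H\<parallel> \<parallel>K\<parallel> \<le> w(T)\<close>. The square of the right-hand side
  of the formula is thus at most \<open>(\<parallel>H\<parallel>\<^sup>2 + \<parallel>K\<parallel>\<^sup>2) / 2 + \<bar>\<parallel>H\<parallel>\<^sup>2 - \<parallel>K\<parallel>\<^sup>2\<bar> / 2 = (max \<parallel>H\<parallel> \<parallel>K\<parallel>)\<^sup>2 \<le> w(T)\<^sup>2\<close>,
  and the theorem is the equality case of this chain.\<close>

section \<open>Inner product calculus and the Cauchy-Schwarz inequality\<close>

interpretation scaleC: vector_space "scaleC :: complex \<Rightarrow> 'a \<Rightarrow> 'a::complex_vector"
  by standard (simp_all add: scaleC_add_right scaleC_add_left scaleC_scaleC scaleC_one)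

lemma cinner_add_right: "cinner x (y + z) = cinner x y + cinner x z"
  by (metis cinner_commute cinner_add_left complex_cnj_add)

lemma cinner_scaleC_right: "cinner x (c *\<^sub>C y) = cnj c * cinner x y"
  by (metis cinner_commute cinner_scaleC_left complex_cnj_mult)

lemma cinner_scaleR_left: "cinner (r *\<^sub>R x) y = of_real r * cinner x y"
  by (simp add: scaleR_scaleC cinner_scaleC_left)

lemma cinner_scaleR_right: "cinner x (r *\<^sub>R y) = of_real r * cinner x y"
  by (simp add: scaleR_scaleC cinner_scaleC_right)

lemma cinner_minus_left: "cinner (- x) y = - cinner x y"
  using cinner_scaleR_left[of "-1" x y] by simp

lemma cinner_minus_right: "cinner x (- y) = - cinner x y"
  using cinner_scaleR_right[of x "-1" y] by simp

lemma cinner_diff_left: "cinner (x - y) z = cinner x z - cinner y z"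
  using cinner_add_left[of x "- y" z] by (simp add: cinner_minus_left)

lemma cinner_diff_right: "cinner x (y - z) = cinner x y - cinner x z"
  using cinner_add_right[of x y "- z"] by (simp add: cinner_minus_right)

lemmas cinner_simps = cinner_add_left cinner_add_right cinner_diff_left cinner_diff_right
  cinner_scaleC_left cinner_scaleC_right cinner_scaleR_left cinner_scaleR_right

lemma Re_cinner_commute: "Re (cinner x y) = Re (cinner y x)"
  by (subst cinner_commute) simp

lemma cinner_self: "cinner x x = of_real ((norm x)\<^sup>2)"
proof -
  have "Im (cinner x x) = 0"
    using arg_cong[OF cinner_commute[of x x], of Im] by simp
  then show ?thesis
    using cinner_self_ge_zero[of x] by (simp add: complex_eq_iff norm_eq_sqrt_cinner)
qed

lemma power2_norm_eq_cinner: "(norm x)\<^sup>2 = Re (cinner x x)"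
  by (simp add: cinner_self)

lemma power2_norm_add: "(norm (x + y))\<^sup>2 = (norm x)\<^sup>2 + 2 * Re (cinner x y) + (norm y)\<^sup>2"
  for x y :: "'a::complex_inner"
  using Re_cinner_commute[of x y] by (simp add: power2_norm_eq_cinner cinner_simps)

lemma power2_norm_diff: "(norm (x - y))\<^sup>2 = (norm x)\<^sup>2 - 2 * Re (cinner x y) + (norm y)\<^sup>2"
  for x y :: "'a::complex_inner"
  using Re_cinner_commute[of x y] by (simp add: power2_norm_eq_cinner cinner_simps)

text \<open>Homogeneity for real scalars is part of the normed space structure; for complex scalars
  it is recovered from the inner product.\<close>

lemma norm_scaleC: "norm (c *\<^sub>C x) = cmod c * norm x"
  for x :: "'a::complex_inner"
proof -
  have "cinner (c *\<^sub>C x) (c *\<^sub>C x) = of_real ((cmod c * norm x)\<^sup>2)"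
    using complex_norm_square[of c]
    unfolding cinner_simps by (simp add: cinner_self power_mult_distrib)
  then have "(norm (c *\<^sub>C x))\<^sup>2 = (cmod c * norm x)\<^sup>2"
    unfolding power2_norm_eq_cinner[of "c *\<^sub>C x"] by (simp only: Re_complex_of_real)
  then show ?thesis by simp
qed

text \<open>The triangle inequality already holds in the class, so squaring it and expanding both
  sides leaves exactly this bound on the cross term. Replacing \<open>x\<close> by
  \<open>- x\<close> gives the absolute value.\<close>

lemma abs_Re_cinner_le: "\<bar>Re (cinner x y)\<bar> \<le> norm x * norm y"
  for x y :: "'a::complex_inner"
proof -
  have "Re (cinner x y) \<le> norm x * norm y"  for x y :: 'a
  proof -
    have "(norm (x + y))\<^sup>2 \<le> (norm x + norm y)\<^sup>2"
      by (intro power_mono norm_triangle_ineq) simp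
    then show ?thesis by (simp add: power2_norm_add power2_sum)
  qed
  from this[of x y] this[of "- x" y] show ?thesis by (simp add: cinner_minus_left abs_le_iff)
qed

text \<open>Multiplying \<open>x\<close> by a unimodular scalar \<open>u\<close> turns the inner
  product into its modulus without changing the norm of \<open>x\<close>, which reduces the claim to
  the real part.\<close>

lemma cmod_cinner_le: "cmod (cinner x y) \<le> norm x * norm y"
  for x y :: "'a::complex_inner"
proof (cases "cinner x y = 0")
  case False
  define u where "u = cnj (sgn (cinner x y))"
  have "cmod u = 1" using False by (simp add: u_def norm_sgn)
  have "Re (cinner (u *\<^sub>C x) y) = cmod (cinner x y)"
  proof -
    have "u * cinner x y = of_real (cmod (cinner x y))"
      using False complex_norm_square[of "cinner x y"]
      by (simp add: u_def sgn_eq field_simps power2_eq_square)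
    then show ?thesis by (simp add: cinner_scaleC_left)
  qed
  moreover have "norm (u *\<^sub>C x) = norm x" using \<open>cmod u = 1\<close> by (simp add: norm_scaleC)
  ultimately show ?thesis using abs_Re_cinner_le[of "u *\<^sub>C x" y] by simp
qed simp

section \<open>Riesz representation and the adjoint\<close>

lemma cinner_ext:
  assumes "\<And>x. cinner x y = cinner x z"
  shows "y = z"
  using assms[of "y - z"] cinner_self_eq_zero_iff[of "y - z"] by (simp add: cinner_diff_right)

text \<open>The representing vector minimises the strictly convex functional \<open>\<parallel>x\<parallel>\<^sup>2 - 2 g x\<close>.\<close>

lemma riesz_representation_real:
  fixes g :: "'a::chilbert_space \<Rightarrow> real"
  assumes g: "bounded_linear g"
  shows "\<exists>z. \<forall>x. g x = Re (cinner x z)"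
proof -
  interpret g: bounded_linear g by (rule g)
  define J where "J x = (norm x)\<^sup>2 - 2 * g x" for x
  obtain C where C: "\<And>x. \<bar>g x\<bar> \<le> norm x * C" using g.bounded by auto
  \<comment> \<open>Completing the square: \<open>J x\<close> is at least
    \<open>(norm x - C)^2 - C^2\<close>.\<close>
  have J_ge: "- C\<^sup>2 \<le> J x" for x
  proof -
    have "0 \<le> (norm x - C)\<^sup>2" by simp
    then show ?thesis using C[of x] by (simp add: J_def power2_diff abs_le_iff)
  qed
  define d where "d = Inf (range J)"
  have bdd: "bdd_below (range J)" using J_ge by (auto intro!: bdd_belowI)
  have d_le: "d \<le> J x" for x unfolding d_def using bdd by (intro cInf_lower) auto
  have "\<exists>x. J x < d + e" if "e > 0" for e
  proof -
    have "Inf (range J) < d + e" using that by (simp add: d_def)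
    then show ?thesis by (subst (asm) cInf_less_iff[OF _ bdd]) auto
  qed
  then have "\<forall>n. \<exists>x. J x < d + 1 / real (Suc n)" by simp
  then obtain X where X: "\<And>n. J (X n) < d + 1 / real (Suc n)" by metis
  \<comment> \<open>Parallelogram law: the midpoint of \<open>x\<close> and \<open>y\<close> cannot
    fall below the infimum \<open>d\<close>, so two near-minimisers must be near each other.\<close>
  have close: "(norm (x - y))\<^sup>2 \<le> 2 * J x + 2 * J y - 4 * d" for x y
  proof -
    have "4 * d \<le> 4 * J ((1/2) *\<^sub>R (x + y))" using d_le by simp
    also have "\<dots> = 2 * J x + 2 * J y - (norm (x - y))\<^sup>2"
      by (simp add: J_def g.scaleR g.add power_divide power2_norm_add power2_norm_diff cinner_simps
          field_simps)
    finally show ?thesis by simp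
  qed
  have "Cauchy X"
  proof (rule metric_CauchyI)
    fix e :: real assume "e > 0"
    \<comment> \<open>Each excess over \<open>d\<close> enters \<open>close\<close> with factor 2,
      so two excesses below \<open>e^2 / 4\<close> bound the squared distance by
      \<open>e^2\<close>.\<close>
    obtain N where N: "1 / real (Suc N) < e\<^sup>2 / 4"
      using \<open>e > 0\<close> nat_approx_posE[of "e\<^sup>2 / 4"] by auto
    show "\<exists>M. \<forall>m\<ge>M. \<forall>n\<ge>M. dist (X m) (X n) < e"
    proof (intro exI allI impI)
      fix m n assume "m \<ge> N" "n \<ge> N"
      then have "J (X m) - d < e\<^sup>2 / 4" "J (X n) - d < e\<^sup>2 / 4"
        using X[of m] X[of n] N
          frac_le[of 1 1 "real (Suc N)" "real (Suc m)"] frac_le[of 1 1 "real (Suc N)" "real (Suc n)"]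
        by auto
      then have "(norm (X m - X n))\<^sup>2 < e\<^sup>2" using close[of "X m" "X n"] by linarith
      then show "dist (X m) (X n) < e"
        using \<open>e > 0\<close> by (simp add: dist_norm power_less_imp_less_base)
    qed
  qed
  then obtain z where z: "X \<longlonglongrightarrow> z" using Cauchy_convergent_iff convergent_def by blast
  \<comment> \<open>By continuity of \<open>J\<close> the limit \<open>z\<close> attains the
    infimum.\<close>
  have "(\<lambda>n. J (X n)) \<longlonglongrightarrow> J z"
    unfolding J_def by (intro tendsto_intros g.tendsto z)
  moreover have "(\<lambda>n. d + 1 / real (Suc n)) \<longlonglongrightarrow> d + 0"
    by (intro tendsto_intros LIMSEQ_Suc[OF lim_1_over_n])
  ultimately have "J z \<le> d + 0"
    by (rule LIMSEQ_le) (use X in \<open>auto intro!: exI[of _ 0] less_imp_le\<close>)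
  then have min: "J z \<le> J x" for x using d_le[of x] by simp
  have "g x = Re (cinner x z)" for x
  proof -
    \<comment> \<open>First variation: moving from the minimiser \<open>z\<close> by
      \<open>t\<close> along \<open>x\<close> changes \<open>J\<close> by a quadratic in
      \<open>t\<close> with linear coefficient \<open>2 * b\<close>, which can stay nonnegative only
      if \<open>b = 0\<close>.\<close>
    define b where "b = Re (cinner x z) - g x"
    have quad: "0 \<le> t\<^sup>2 * (norm x)\<^sup>2 + 2 * t * b" for t
      using min[of "z + t *\<^sub>R x"] Re_cinner_commute[of x z]
      by (simp add: J_def b_def g.add g.scaleR power2_norm_add cinner_simps power_mult_distrib
          algebra_simps)
    \<comment> \<open>The quadratic is tested at \<open>t = - b / s\<close>, where the added 1 keeps
      \<open>s\<close> positive even for \<open>x = 0\<close>.\<close>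
    define s where "s = 1 + (norm x)\<^sup>2"
    have "s > 0" by (simp add: s_def add_pos_nonneg)
    have "0 \<le> b\<^sup>2 / s\<^sup>2 * (norm x)\<^sup>2 - 2 * b\<^sup>2 / s"
      using quad[of "- b / s"] by (simp add: power_divide power2_eq_square)
    also have "\<dots> \<le> b\<^sup>2 / s\<^sup>2 * s - 2 * b\<^sup>2 / s"
      by (intro diff_right_mono mult_left_mono) (auto simp: s_def)
    also have "\<dots> = - (b\<^sup>2 / s)" using \<open>s > 0\<close> by (simp add: field_simps power2_eq_square)
    finally have "b\<^sup>2 / s \<le> 0" by simp
    then have "b = 0" using \<open>s > 0\<close> by (simp add: divide_le_0_iff)
    then show ?thesis by (simp add: b_def)
  qed
  then show ?thesis by blast
qed

text \<open>For fixed \<open>y\<close>, the real Riesz theorem represents the real part of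
  \<open>cinner (T x) y\<close>. Complex linearity, applied at \<open>\<i> *\<^sub>C x\<close>,
  makes the imaginary parts agree as well.\<close>

lemma adjoint_exists:
  fixes T :: "'a::chilbert_space \<Rightarrow> 'a"
  assumes "bounded_clinear T"
  shows "\<exists>S. \<forall>x y. cinner (T x) y = cinner x (S y)"
proof -
  interpret T: bounded_linear T using assms by (simp add: bounded_clinear_def)
  have clin: "T (c *\<^sub>C x) = c *\<^sub>C T x" for c x using assms by (simp add: bounded_clinear_def)
  have "\<exists>z. \<forall>x. cinner (T x) y = cinner x z" for y
  proof -
    have "bounded_linear (\<lambda>x. Re (cinner (T x) y))"
    proof (rule bounded_linear_intro)
      show "norm (Re (cinner (T x) y)) \<le> norm x * (onorm T * norm y)" for x
        using abs_Re_cinner_le[of "T x" y]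
          mult_right_mono[OF onorm[OF T.bounded_linear_axioms, of x], of "norm y"]
        by (simp add: mult_ac)
    qed (simp_all add: T.add T.scaleR cinner_simps)
    then obtain z where z: "\<And>x. Re (cinner (T x) y) = Re (cinner x z)"
      using riesz_representation_real by blast
    have "cinner (T x) y = cinner x z" for x
      using z[of x] z[of "\<i> *\<^sub>C x"] by (simp add: complex_eq_iff clin cinner_simps)
    then show ?thesis by blast
  qed
  then show ?thesis by metis
qed

text \<open>Justifies the definite description in \<open>cadjoint\<close>: existence comes from
  Riesz, uniqueness from testing against all vectors.\<close>

lemma cinner_cadjoint:
  fixes T :: "'a::chilbert_space \<Rightarrow> 'a"
  assumes "bounded_clinear T"
  shows "cinner (T x) y = cinner x (cadjoint T y)"
proof -
  have "\<exists>!S. \<forall>x y. cinner (T x) y = cinner x (S y)"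
  proof (rule ex_ex1I)
    fix R S
    assume R: "\<forall>x y. cinner (T x) y = cinner x (R y)" and S: "\<forall>x y. cinner (T x) y = cinner x (S y)"
    show "R = S"
      by (rule ext, rule cinner_ext) (simp flip: R[rule_format] add: S[rule_format, symmetric])
  qed (rule adjoint_exists[OF assms])
  then have "\<forall>x y. cinner (T x) y = cinner x (cadjoint T y)"
    unfolding cadjoint_def by (rule theI')
  then show ?thesis by blast
qed

lemma cinner_cadjoint_left:
  assumes "bounded_clinear T"
  shows "cinner (cadjoint T x) y = cinner x (T y)"
proof -
  have "cinner (cadjoint T x) y = cnj (cinner y (cadjoint T x))" by (rule cinner_commute)
  also have "\<dots> = cnj (cinner (T y) x)" by (simp only: cinner_cadjoint[OF assms])
  also have "\<dots> = cinner x (T y)" by (rule cinner_commute[symmetric])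
  finally show ?thesis .
qed

text \<open>Linearity follows by testing against all vectors. For boundedness, the squared norm of
  \<open>cadjoint T y\<close> is the real part of \<open>cinner (T (cadjoint T y)) y\<close>;
  Cauchy-Schwarz bounds this, and one factor \<open>norm (cadjoint T y)\<close> cancels.\<close>

lemma bounded_clinear_cadjoint:
  fixes T :: "'a::chilbert_space \<Rightarrow> 'a"
  assumes T: "bounded_clinear T"
  shows "bounded_clinear (cadjoint T)"
proof -
  interpret T: bounded_linear T using assms by (simp add: bounded_clinear_def)
  have add: "cadjoint T (x + y) = cadjoint T x + cadjoint T y" for x y
    by (rule cinner_ext) (simp add: cinner_add_right flip: cinner_cadjoint[OF T])
  have scaleC: "cadjoint T (c *\<^sub>C x) = c *\<^sub>C cadjoint T x" for c x
    by (rule cinner_ext) (simp add: cinner_scaleC_right flip: cinner_cadjoint[OF T])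
  have "norm (cadjoint T y) \<le> norm y * onorm T" for y
  proof (cases "cadjoint T y = 0")
    case True
    then show ?thesis by (simp add: onorm_pos_le T.bounded_linear_axioms)
  next
    case False
    have "(norm (cadjoint T y))\<^sup>2 = Re (cinner (T (cadjoint T y)) y)"
      by (simp add: cinner_cadjoint[OF T] power2_norm_eq_cinner)
    also have "\<dots> \<le> norm (T (cadjoint T y)) * norm y"
      using abs_Re_cinner_le abs_le_iff by blast
    also have "\<dots> \<le> (onorm T * norm (cadjoint T y)) * norm y"
      by (intro mult_right_mono onorm T.bounded_linear_axioms) simp
    finally show ?thesis using False by (simp add: power2_eq_square mult_ac)
  qed
  moreover have "cadjoint T (r *\<^sub>R x) = r *\<^sub>R cadjoint T x" for r x
    by (simp add: scaleC scaleR_scaleC)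
  ultimately have "bounded_linear (cadjoint T)"
    using add by (intro bounded_linear_intro)
  then show ?thesis by (simp add: bounded_clinear_def scaleC)
qed

section \<open>Real and imaginary parts as bounded complex-linear operators\<close>

lemma bounded_clinear_add:
  assumes "bounded_clinear A" "bounded_clinear B"
  shows "bounded_clinear (\<lambda>x. A x + B x)"
  using assms by (simp add: bounded_clinear_def bounded_linear_add scaleC.scale_right_distrib)

lemma bounded_clinear_diff:
  assumes "bounded_clinear A" "bounded_clinear B"
  shows "bounded_clinear (\<lambda>x. A x - B x)"
  using assms by (simp add: bounded_clinear_def bounded_linear_sub scaleC.scale_right_diff_distrib)

lemma bounded_clinear_scaleC:
  assumes "bounded_clinear A"
  shows "bounded_clinear (\<lambda>x. c *\<^sub>C A x)"
proof -
  interpret A: bounded_linear A using assms by (simp add: bounded_clinear_def)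
  have "bounded_linear (\<lambda>x. c *\<^sub>C A x)"
  proof (rule bounded_linear_intro)
    show "norm (c *\<^sub>C A x) \<le> norm x * (cmod c * onorm A)" for x
      using mult_left_mono[OF onorm[OF A.bounded_linear_axioms, of x], of "cmod c"]
      by (simp add: norm_scaleC mult_ac)
  qed (simp_all add: A.add A.scaleR scaleC.scale_right_distrib, simp add: scaleR_scaleC mult.commute)
  then show ?thesis using assms by (simp add: bounded_clinear_def mult.commute)
qed

lemma bounded_clinear_real_part_op:
  assumes "bounded_clinear T"
  shows "bounded_clinear (real_part_op T)"
  unfolding real_part_op_def
  by (intro bounded_clinear_scaleC bounded_clinear_add bounded_clinear_cadjoint assms)

lemma bounded_clinear_imag_part_op:
  assumes "bounded_clinear T"
  shows "bounded_clinear (imag_part_op T)"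
  unfolding imag_part_op_def
  by (intro bounded_clinear_scaleC bounded_clinear_diff bounded_clinear_cadjoint assms)

section \<open>Numerical radius bounds for the real and imaginary parts\<close>

lemma cinner_le_numerical_radius:
  assumes "bounded_clinear T"
  shows "cmod (cinner (T x) x) \<le> numerical_radius T * (norm x)\<^sup>2"
    and "0 \<le> numerical_radius T"
proof -
  interpret T: bounded_linear T using assms by (simp add: bounded_clinear_def)
  \<comment> \<open>Cauchy-Schwarz bounds the set, so the supremum is a genuine upper bound.\<close>
  have bdd: "bdd_above (insert 0 {cmod (cinner (T x) x) | x. norm x = 1})"
  proof (rule bdd_aboveI[of _ "onorm T"])
    fix r assume "r \<in> insert 0 {cmod (cinner (T x) x) | x. norm x = 1}"
    moreover have "cmod (cinner (T x) x) \<le> onorm T" if "norm x = 1" for x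
      using cmod_cinner_le[of "T x" x] onorm[OF T.bounded_linear_axioms, of x] that by simp
    ultimately show "r \<le> onorm T" by (auto simp: onorm_pos_le T.bounded_linear_axioms)
  qed
  \<comment> \<open>The inserted 0 gives this even on the zero space, which has no unit
    vectors.\<close>
  show "0 \<le> numerical_radius T"
    unfolding numerical_radius_def by (rule cSup_upper[OF _ bdd]) simp
  show "cmod (cinner (T x) x) \<le> numerical_radius T * (norm x)\<^sup>2"
  proof (cases "x = 0")
    case True
    then show ?thesis by (simp add: T.zero cinner_self)
  next
    case False
    define u where "u = (1 / norm x) *\<^sub>R x"
    have "norm u = 1" using False by (simp add: u_def)
    then have "cmod (cinner (T u) u) \<le> numerical_radius T"
      unfolding numerical_radius_def by (intro cSup_upper[OF _ bdd]) auto
    moreover have "cmod (cinner (T u) u) = cmod (cinner (T x) x) / (norm x)\<^sup>2"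
      by (simp add: u_def T.scaleR cinner_simps norm_mult norm_divide power2_eq_square)
    ultimately show ?thesis using False by (simp add: field_simps)
  qed
qed

text \<open>Self-adjointness makes both cross terms of the quadratic form have the same real part,
  so polarisation expresses \<open>Re (cinner (A x) y)\<close> through the form at
  \<open>x + y\<close> and \<open>x - y\<close>. The parallelogram law then bounds it.\<close>

lemma onorm_selfadjoint_le:
  fixes A :: "'a::complex_inner \<Rightarrow> 'a"
  assumes A: "bounded_linear A" and sa: "\<And>x y. cinner (A x) y = cinner x (A y)"
    and "0 \<le> w" and le: "\<And>x. \<bar>Re (cinner (A x) x)\<bar> \<le> w * (norm x)\<^sup>2"
  shows "onorm A \<le> w"
proof (rule onorm_bound)
  interpret bounded_linear A by (rule A)
  fix x
  have polar: "4 * Re (cinner (A x) y) \<le> 2 * w * ((norm x)\<^sup>2 + (norm y)\<^sup>2)" for y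
  proof -
    have "Re (cinner (A y) x) = Re (cinner (A x) y)"
      using sa[of y x] Re_cinner_commute by metis
    then have "4 * Re (cinner (A x) y)
        = Re (cinner (A (x + y)) (x + y)) - Re (cinner (A (x - y)) (x - y))"
      by (simp add: add diff cinner_simps)
    also have "\<dots> \<le> w * (norm (x + y))\<^sup>2 + w * (norm (x - y))\<^sup>2"
      using le[of "x + y"] le[of "x - y"] by linarith
    also have "\<dots> = 2 * w * ((norm x)\<^sup>2 + (norm y)\<^sup>2)"
      by (simp add: power2_norm_add power2_norm_diff algebra_simps)
    finally show ?thesis .
  qed
  show "norm (A x) \<le> w * norm x"
  proof (cases "A x = 0 \<or> x = 0")
    case True
    then show ?thesis using \<open>0 \<le> w\<close> by (auto simp: zero)
  next
    case False
    \<comment> \<open>The test vector points along \<open>A x\<close> and is scaled to the norm of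
      \<open>x\<close>, which balances the two squares in \<open>polar\<close>.\<close>
    define t where "t = norm x / norm (A x)"
    have "Re (cinner (A x) (t *\<^sub>R A x)) = norm x * norm (A x)"
      using False by (simp add: cinner_simps cinner_self t_def power2_eq_square)
    moreover have "norm (t *\<^sub>R A x) = norm x" using False by (simp add: t_def)
    ultimately have "norm x * norm (A x) \<le> norm x * (w * norm x)"
      using polar[of "t *\<^sub>R A x"] by (simp add: power2_eq_square mult_ac)
    then show ?thesis using False by simp
  qed
qed fact

lemma onorm_real_part_op_le:
  assumes T: "bounded_clinear T"
  shows "onorm (real_part_op T) \<le> numerical_radius T"
proof (rule onorm_selfadjoint_le)
  show "bounded_linear (real_part_op T)"
    using bounded_clinear_real_part_op[OF T] by (simp add: bounded_clinear_def)
  show "cinner (real_part_op T x) y = cinner x (real_part_op T y)" for x y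
    by (simp add: real_part_op_def cinner_simps cinner_cadjoint[OF T] cinner_cadjoint_left[OF T])
  show "\<bar>Re (cinner (real_part_op T x) x)\<bar> \<le> numerical_radius T * (norm x)\<^sup>2" for x
  proof -
    have "Re (cinner (real_part_op T x) x) = Re (cinner (T x) x)"
      using Re_cinner_commute[of x "T x"]
      by (simp add: real_part_op_def cinner_simps cinner_cadjoint_left[OF T])
    then show ?thesis
      using abs_Re_le_cmod cinner_le_numerical_radius(1)[OF T] order_trans by metis
  qed
qed (rule cinner_le_numerical_radius(2)[OF T])

lemma onorm_imag_part_op_le:
  assumes T: "bounded_clinear T"
  shows "onorm (imag_part_op T) \<le> numerical_radius T"
proof (rule onorm_selfadjoint_le)
  show "bounded_linear (imag_part_op T)"
    using bounded_clinear_imag_part_op[OF T] by (simp add: bounded_clinear_def)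
  show "cinner (imag_part_op T x) y = cinner x (imag_part_op T y)" for x y
    by (simp add: imag_part_op_def cinner_simps cinner_cadjoint[OF T] cinner_cadjoint_left[OF T]
        field_simps)
  show "\<bar>Re (cinner (imag_part_op T x) x)\<bar> \<le> numerical_radius T * (norm x)\<^sup>2" for x
  proof -
    have "Im (cinner x (T x)) = - Im (cinner (T x) x)"
      by (subst cinner_commute) simp
    then have "Re (cinner (imag_part_op T x) x) = Im (cinner (T x) x)"
      by (simp add: imag_part_op_def cinner_simps cinner_minus_left cinner_cadjoint_left[OF T])
    then show ?thesis
      using abs_Im_le_cmod cinner_le_numerical_radius(1)[OF T] order_trans by metis
  qed
qed (rule cinner_le_numerical_radius(2)[OF T])

section \<open>The anticommutator of the operator and its adjoint\<close>

lemma cadjoint_anticommutator_eq: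
  assumes T: "bounded_clinear T"
  shows "cadjoint T (T x) + T (cadjoint T x)
    = 2 *\<^sub>C (real_part_op T (real_part_op T x) + imag_part_op T (imag_part_op T x))"
proof -
  interpret T: bounded_linear T using T by (simp add: bounded_clinear_def)
  interpret S: bounded_linear "cadjoint T"
    using bounded_clinear_cadjoint[OF T] by (simp add: bounded_clinear_def)
  have clin: "T (c *\<^sub>C x) = c *\<^sub>C T x" "cadjoint T (c *\<^sub>C x) = c *\<^sub>C cadjoint T x" for c x
    using T bounded_clinear_cadjoint[OF T] by (simp_all add: bounded_clinear_def)
  define a b c d where "a = T (T x)" and "b = T (cadjoint T x)"
    and "c = cadjoint T (T x)" and "d = cadjoint T (cadjoint T x)"
  have H: "real_part_op T (real_part_op T x) = (1/4) *\<^sub>C (a + b + c + d)"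
    by (simp add: real_part_op_def T.add S.add clin a_def b_def c_def d_def
        scaleC.scale_right_distrib)
  \<comment> \<open>The square of \<open>1 / (2 * \<i>)\<close> is \<open>- 1/4\<close>, so
    \<open>a\<close> and \<open>d\<close> have signs opposite to those in \<open>H\<close> and
    cancel in the sum, while the mixed products \<open>b\<close> and \<open>c\<close> add
    up.\<close>
  have K: "imag_part_op T (imag_part_op T x) = (1/4) *\<^sub>C (b + c - a - d)"
    by (simp add: imag_part_op_def T.diff S.diff clin a_def b_def c_def d_def
        scaleC.scale_right_distrib scaleC.scale_right_diff_distrib)
  \<comment> \<open>The sum is written as two copies of \<open>b + c\<close> so that distributivity
    can merge the coefficients into \<open>1/4 + 1/4\<close>.\<close>
  have "real_part_op T (real_part_op T x) + imag_part_op T (imag_part_op T x)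
      = (1/4) *\<^sub>C ((b + c) + (b + c))"
    unfolding H K scaleC.scale_right_distrib[symmetric] by (simp add: algebra_simps)
  also have "\<dots> = (1/4 + 1/4) *\<^sub>C (b + c)"
    by (simp only: scaleC.scale_right_distrib[of _ "b + c" "b + c"] scaleC.scale_left_distrib)
  finally show ?thesis by (simp add: b_def c_def add.commute)
qed

text \<open>Triangle inequality on the sum of squares from
  \<open>cadjoint_anticommutator_eq\<close>, with each square bounded by submultiplicativity of the
  operator norm.\<close>

lemma onorm_cadjoint_anticommutator_le:
  assumes T: "bounded_clinear T"
  shows "1 / 2 * onorm (\<lambda>x. cadjoint T (T x) + T (cadjoint T x))
    \<le> (onorm (real_part_op T))\<^sup>2 + (onorm (imag_part_op T))\<^sup>2"
proof -
  have square: "norm (A (A x)) \<le> (onorm A)\<^sup>2 * norm x"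
    if "bounded_clinear A" for A :: "'a \<Rightarrow> 'a" and x
  proof -
    have A: "bounded_linear A" using that by (simp add: bounded_clinear_def)
    have "norm (A (A x)) \<le> onorm A * norm (A x)" by (rule onorm[OF A])
    also have "\<dots> \<le> onorm A * (onorm A * norm x)"
      by (intro mult_left_mono onorm[OF A] onorm_pos_le[OF A])
    finally show ?thesis by (simp add: power2_eq_square)
  qed
  have "onorm (\<lambda>x. cadjoint T (T x) + T (cadjoint T x))
      \<le> 2 * ((onorm (real_part_op T))\<^sup>2 + (onorm (imag_part_op T))\<^sup>2)"
  proof (rule onorm_bound)
    fix x
    show "norm (cadjoint T (T x) + T (cadjoint T x))
        \<le> 2 * ((onorm (real_part_op T))\<^sup>2 + (onorm (imag_part_op T))\<^sup>2) * norm x"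
      using square[OF bounded_clinear_real_part_op[OF T], of x]
        square[OF bounded_clinear_imag_part_op[OF T], of x]
        norm_triangle_ineq[of "real_part_op T (real_part_op T x)" "imag_part_op T (imag_part_op T x)"]
      unfolding cadjoint_anticommutator_eq[OF T] norm_scaleC by (simp add: algebra_simps)
  qed simp
  then show ?thesis by simp
qed

section \<open>Equality case of the chain of bounds\<close>

theorem mainTheorem14:
  fixes T :: "'a::chilbert_space \<Rightarrow> 'a"
  assumes "bounded_clinear T"
  shows "numerical_radius T =
      sqrt (1 / 4 * onorm (\<lambda>x. cadjoint T (T x) + T (cadjoint T x))
        + 1 / 2 * \<bar>(onorm (real_part_op T))\<^sup>2 - (onorm (imag_part_op T))\<^sup>2\<bar>)
    \<longleftrightarrow>
      1 / 2 * onorm (\<lambda>x. cadjoint T (T x) + T (cadjoint T x))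
        = (onorm (real_part_op T))\<^sup>2 + (onorm (imag_part_op T))\<^sup>2
      \<and> numerical_radius T = max (onorm (real_part_op T)) (onorm (imag_part_op T))"
proof -
  define w A h k where "w = numerical_radius T"
    and "A = onorm (\<lambda>x. cadjoint T (T x) + T (cadjoint T x))"
    and "h = onorm (real_part_op T)" and "k = onorm (imag_part_op T)"
  have "0 \<le> h" "0 \<le> k"
    using bounded_clinear_real_part_op[OF assms] bounded_clinear_imag_part_op[OF assms]
    by (auto simp: h_def k_def bounded_clinear_def intro: onorm_pos_le)
  have "0 \<le> w" using cinner_le_numerical_radius(2)[OF assms] by (simp add: w_def)
  have "max h k \<le> w"
    using onorm_real_part_op_le[OF assms] onorm_imag_part_op_le[OF assms]
    by (simp add: w_def h_def k_def)
  have A_le: "1 / 2 * A \<le> h\<^sup>2 + k\<^sup>2"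
    using onorm_cadjoint_anticommutator_le[OF assms] by (simp add: A_def h_def k_def)
  \<comment> \<open>The larger of two reals is half their sum plus half their distance, applied to
    the squares; squaring preserves the order of \<open>h\<close> and \<open>k\<close> as both are
    nonnegative.\<close>
  have max: "(max h k)\<^sup>2 = (h\<^sup>2 + k\<^sup>2) / 2 + 1 / 2 * \<bar>h\<^sup>2 - k\<^sup>2\<bar>"
    using power_mono[of h k 2] power_mono[of k h 2] \<open>0 \<le> h\<close> \<open>0 \<le> k\<close>
    by (cases "h \<le> k") (auto simp: max_def add_divide_distrib diff_divide_distrib)
  have max_le: "(max h k)\<^sup>2 \<le> w\<^sup>2"
    using \<open>max h k \<le> w\<close> \<open>0 \<le> h\<close> by (intro power_mono) auto
  have "w = sqrt (1 / 4 * A + 1 / 2 * \<bar>h\<^sup>2 - k\<^sup>2\<bar>) \<longleftrightarrow> 1 / 2 * A = h\<^sup>2 + k\<^sup>2 \<and> w = max h k"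
  proof
    assume w: "w = sqrt (1 / 4 * A + 1 / 2 * \<bar>h\<^sup>2 - k\<^sup>2\<bar>)"
    then have "w\<^sup>2 = 1 / 4 * A + 1 / 2 * \<bar>h\<^sup>2 - k\<^sup>2\<bar>"
      using \<open>0 \<le> w\<close> by simp
    \<comment> \<open>The chain from \<open>w^2\<close> through \<open>(max h k)^2\<close> back to
      \<open>w^2\<close> closes up, so neither \<open>A_le\<close> nor \<open>max_le\<close> can be
      strict.\<close>
    moreover from this have "1 / 2 * A = h\<^sup>2 + k\<^sup>2"
      using A_le max max_le by argo
    ultimately have "1 / 2 * A = h\<^sup>2 + k\<^sup>2" "w\<^sup>2 = (max h k)\<^sup>2"
      using max by argo+
    then show "1 / 2 * A = h\<^sup>2 + k\<^sup>2 \<and> w = max h k"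
      using power2_eq_imp_eq[of w "max h k"] \<open>0 \<le> w\<close> \<open>0 \<le> h\<close> by (simp add: le_max_iff_disj)
  next
    assume eq: "1 / 2 * A = h\<^sup>2 + k\<^sup>2 \<and> w = max h k"
    then have "w\<^sup>2 = (h\<^sup>2 + k\<^sup>2) / 2 + 1 / 2 * \<bar>h\<^sup>2 - k\<^sup>2\<bar>" using max by simp
    with eq have "w\<^sup>2 = 1 / 4 * A + 1 / 2 * \<bar>h\<^sup>2 - k\<^sup>2\<bar>" by simp
    then show "w = sqrt (1 / 4 * A + 1 / 2 * \<bar>h\<^sup>2 - k\<^sup>2\<bar>)"
      using \<open>0 \<le> w\<close> by (simp only: real_sqrt_unique)
  qed
  then show ?thesis by (simp only: w_def A_def h_def k_def)
qed

end
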